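(* Let $s\ge1$ and let $S\subseteq\{0,1,\dots,s\}$ be non-empty. Then \[ \ell(S)\le\min\Bigl\{2^s,\ 2\sum_{0\le t\le 2s\tau(S)}\binom st\Bigr\}. \] Furthermore, there is a function $f(k)$ with $f(k)\to0$ as $k\to\infty$ such that $\ell(S)\le 2^{sf(k)}$ for all $s\ge 1$ and all $S\subseteq\{0,\dots,s\}$ with $|S|=k$.
   Context: For a finite non-empty $S\subset\mathbb Z$ and $n\ge1$, $\tau(S,n)=\min\{|T|:T\subseteq\mathbb Z,\ T+S\supseteq\{1,\dots,n\}\}$, and $\tau(S)=\lim_{n\to\infty}\tau(S,n)/n$. A set $T\subseteq\mathbb Z$ is periodic with period $\ell$ if $T+\ell=T$, with density $|T\cap\{0,\dots,\ell-1\}|/\ell$. An optimal periodic covering is a periodic $T$ with $T+S=\mathbb Z$ and density equal to $\tau(S)$ (such $T$ exist). $\ell(S)$ denotes the minimum period of an optimal periodic covering by translates of $S$. *)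

theory Defs
  imports Complex_Main "HOL-Library.Set_Algebras"
begin

text \<open>The set sum \<open>T + S\<close> and the translate \<open>a +o T\<close> are those of \<^theory>\<open>HOL-Library.Set_Algebras\<close>.\<close>

(* Finiteness of T is explicit because card is 0 on infinite sets. *)
definition tau_upto :: "int set \<Rightarrow> nat \<Rightarrow> nat" where
  "tau_upto S n = (LEAST m. \<exists>T. finite T \<and> card T = m \<and> {1..int n} \<subseteq> T + S)"

definition tau :: "int set \<Rightarrow> real" where
  "tau S = lim (\<lambda>n. real (tau_upto S n) / real n)"

definition periodic_with :: "int set \<Rightarrow> nat \<Rightarrow> bool" where
  "periodic_with T l \<longleftrightarrow> l \<ge> 1 \<and> int l +o T = T"

definition periodic_density :: "int set \<Rightarrow> nat \<Rightarrow> real" where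
  "periodic_density T l = real (card (T \<inter> {0..<int l})) / real l"

definition optimal_periodic_covering :: "int set \<Rightarrow> int set \<Rightarrow> nat \<Rightarrow> bool" where
  "optimal_periodic_covering S T l \<longleftrightarrow>
     periodic_with T l \<and> T + S = UNIV \<and> periodic_density T l = tau S"

(* LEAST rather than Inf: were there no optimal periodic covering, Inf would be 0
   and upper bounds on the minimum period would hold for no reason. *)
definition min_period :: "int set \<Rightarrow> nat" where
  "min_period S = (LEAST l. \<exists>T. optimal_periodic_covering S T l)"

end

theory Submission
  imports Defs "HOL-Real_Asymp.Real_Asymp"
begin

text \<open>
  A covering \<open>T\<close> with period \<open>l\<close> is a closed walk through its windows of length \<open>s\<close>. Two equal
  windows within one period split it into two periodic coverings whose periods and numbers of
  elements add up. Hence the minimal density is attained with period at most \<open>2 ^ s\<close>, it equals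
  \<open>tau S\<close> (wrapping a finite covering of \<open>{1..n}\<close> modulo \<open>n\<close> gives one of period \<open>n\<close>), and an
  optimal covering of minimal period has pairwise distinct windows. Counting all windows gives
  \<open>2 ^ s\<close>; counting only those with at most twice the average number of elements gives the
  binomial sum. For the asymptotic bound, a greedy covering shows \<open>tau S \<le> 2 / sqrt (card S)\<close>.
\<close>

section \<open>Pointwise descriptions of coverings and periodicity, and counts over blocks\<close>

lemma plus_eq_UNIV_iff:
  fixes T S :: "int set"
  shows "T + S = UNIV \<longleftrightarrow> (\<forall>z. \<exists>a\<in>S. z - a \<in> T)"
proof
  assume *: "T + S = UNIV"
  show "\<forall>z. \<exists>a\<in>S. z - a \<in> T"
  proof
    fix z
    have "z \<in> T + S" using * by simp
    then obtain t a where "t \<in> T" "a \<in> S" "z = t + a" by (auto elim: set_plus_elim)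
    then show "\<exists>a\<in>S. z - a \<in> T" by (intro bexI[of _ a]) auto
  qed
next
  assume *: "\<forall>z. \<exists>a\<in>S. z - a \<in> T"
  have "z \<in> T + S" for z
  proof -
    obtain a where "a \<in> S" "z - a \<in> T" using * by blast
    then have "(z - a) + a \<in> T + S" by (rule set_plus_intro[rotated])
    then show ?thesis by simp
  qed
  then show "T + S = UNIV" by blast
qed

lemma periodic_with_iff:
  "periodic_with T l \<longleftrightarrow> l \<ge> 1 \<and> (\<forall>z. z + int l \<in> T \<longleftrightarrow> z \<in> T)"
proof -
  have "int l +o T = T \<longleftrightarrow> (\<forall>z. z + int l \<in> T \<longleftrightarrow> z \<in> T)"
  proof
    assume *: "int l +o T = T"
    show "\<forall>z. z + int l \<in> T \<longleftrightarrow> z \<in> T"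
    proof
      fix z
      have "z + int l \<in> int l +o T \<longleftrightarrow> z \<in> T"
        by (auto simp: elt_set_plus_def algebra_simps)
      then show "z + int l \<in> T \<longleftrightarrow> z \<in> T" by (simp add: *)
    qed
  next
    assume *: "\<forall>z. z + int l \<in> T \<longleftrightarrow> z \<in> T"
    show "int l +o T = T"
    proof (rule set_eqI)
      fix z
      have "z \<in> int l +o T \<longleftrightarrow> z - int l \<in> T"
        by (auto simp: elt_set_plus_def intro!: bexI[of _ "z - int l"])
      also have "\<dots> \<longleftrightarrow> z \<in> T" using *[rule_format, of "z - int l"] by simp
      finally show "z \<in> int l +o T \<longleftrightarrow> z \<in> T" .
    qed
  qed
  then show ?thesis by (simp add: periodic_with_def)
qed

lemma periodic_with_multiple:
  assumes "periodic_with T l"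
  shows "z + int k * int l \<in> T \<longleftrightarrow> z \<in> T"
proof (induction k)
  case (Suc k)
  have "z + int (Suc k) * int l = (z + int k * int l) + int l" by (simp add: algebra_simps)
  then show ?case using assms Suc unfolding periodic_with_iff by metis
qed simp

lemma periodic_with_mod:
  assumes "periodic_with T l"
  shows "z mod int l \<in> T \<longleftrightarrow> z \<in> T"
proof (cases "z div int l \<ge> 0")
  case True
  then show ?thesis
    using periodic_with_multiple[OF assms, of "z mod int l" "nat (z div int l)"] by simp
next
  \<comment> \<open>\<open>periodic_with_multiple\<close> only adds nonnegative multiples of the
    period, so here one climbs from \<open>z\<close> up to its residue.\<close>
  case False
  have "z + int (nat (- (z div int l))) * int l = z mod int l"
    using False by (simp add: minus_div_mult_eq_mod[symmetric])
  then show ?thesis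
    using periodic_with_multiple[OF assms, of z "nat (- (z div int l))"] by simp
qed

lemma periodic_with_cong:
  assumes "periodic_with T l" "z mod int l = w mod int l"
  shows "z \<in> T \<longleftrightarrow> w \<in> T"
  using periodic_with_mod[OF assms(1)] assms(2) by metis

lemma card_periodic_block:
  assumes "periodic_with T l"
  shows "card (T \<inter> {x..<x + int l}) = card (T \<inter> {0..<int l})"
proof (rule bij_betw_same_card)
  have l: "int l > 0" using assms by (simp add: periodic_with_iff)
  show "bij_betw (\<lambda>z. z mod int l) (T \<inter> {x..<x + int l}) (T \<inter> {0..<int l})"
  \<comment> \<open>The map \<open>f'\<close> sends an integer to its representative modulo
    \<open>l\<close> in the block starting at \<open>x\<close>.\<close>
  proof (rule bij_betw_byWitness[where f' = "\<lambda>z. x + (z - x) mod int l"])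
    show "\<forall>z\<in>T \<inter> {x..<x + int l}. x + (z mod int l - x) mod int l = z"
      by (auto simp: mod_simps)
    show "\<forall>z\<in>T \<inter> {0..<int l}. (x + (z - x) mod int l) mod int l = z"
      by (auto simp: mod_simps)
    show "(\<lambda>z. z mod int l) ` (T \<inter> {x..<x + int l}) \<subseteq> T \<inter> {0..<int l}"
      using l periodic_with_mod[OF assms] by auto
    have "x + (z - x) mod int l \<in> T \<longleftrightarrow> z \<in> T" for z
      by (rule periodic_with_cong[OF assms]) (simp add: mod_simps)
    then show "(\<lambda>z. x + (z - x) mod int l) ` (T \<inter> {0..<int l}) \<subseteq> T \<inter> {x..<x + int l}"
      using l by auto
  qed
qed

lemma card_periodic_blocks:
  assumes "periodic_with T l"
  shows "card (T \<inter> {x..<x + int q * int l}) = q * card (T \<inter> {0..<int l})"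
proof (induction q)
  case (Suc q)
  have "T \<inter> {x..<x + int (Suc q) * int l} =
      (T \<inter> {x..<x + int q * int l}) \<union>
      (T \<inter> {x + int q * int l..<(x + int q * int l) + int l})"
    by (auto simp: algebra_simps) (smt (verit) of_nat_0_le_iff mult_nonneg_nonneg)+
  then have "card (T \<inter> {x..<x + int (Suc q) * int l}) =
      card (T \<inter> {x..<x + int q * int l}) +
      card (T \<inter> {x + int q * int l..<(x + int q * int l) + int l})"
    by (simp only:) (rule card_Un_disjoint; auto)
  then show ?case using Suc card_periodic_block[OF assms] by simp
qed simp

section \<open>Windows and the splitting of periodic coverings\<close>

text \<open>Records the integers \<open>l\<close> and \<open>c\<close> instead of the density
  \<open>c / l\<close>, because both are additive under splitting. The period \<open>l\<close> need
  not be the least one of \<open>T\<close>.\<close>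

definition periodic_covering :: "int set \<Rightarrow> nat \<Rightarrow> nat \<Rightarrow> bool" where
  "periodic_covering S l c \<longleftrightarrow>
     (\<exists>T. periodic_with T l \<and> T + S = UNIV \<and> card (T \<inter> {0..<int l}) = c)"

lemma periodic_covering_pos: "periodic_covering S l c \<Longrightarrow> l \<ge> 1"
  by (auto simp: periodic_covering_def periodic_with_def)

lemma periodic_covering_le: "periodic_covering S l c \<Longrightarrow> c \<le> l"
  unfolding periodic_covering_def
  by (metis Int_lower2 card_atLeastLessThan_int card_mono diff_zero
      finite_atLeastLessThan_int nat_int)

lemma periodic_covering_card_pos:
  assumes "periodic_covering S l c"
  shows "c \<ge> 1"
proof -
  obtain T where T: "periodic_with T l" "T + S = UNIV" "card (T \<inter> {0..<int l}) = c"
    using assms unfolding periodic_covering_def by blast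
  obtain a where "0 - a \<in> T" using T(2) unfolding plus_eq_UNIV_iff by blast
  then have "(0 - a) mod int l \<in> T \<inter> {0..<int l}"
    using periodic_with_mod[OF T(1)] T(1) by (auto simp: periodic_with_iff)
  then have "card (T \<inter> {0..<int l}) \<noteq> 0" by (subst card_0_eq) auto
  then show ?thesis using T(3) by simp
qed

text \<open>The state of the walk: the part of \<open>T\<close> in \<open>s\<close> consecutive
  places, shifted to start at 0. Whether an integer is covered depends on \<open>s + 1\<close>
  consecutive places, that is, on two successive states.\<close>

definition window :: "nat \<Rightarrow> int set \<Rightarrow> int \<Rightarrow> nat set" where
  "window s T x = {i. i < s \<and> x + int i \<in> T}"

text \<open>Repeat the block of \<open>T\<close> on the \<open>d\<close> places from
  \<open>x\<close>. Since the windows at both ends agree, the repeated set coincides with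
  \<open>T\<close> on \<open>d + s\<close> places, long enough to contain, for every residue modulo
  \<open>d\<close>, all places that decide whether some integer of that residue is covered.\<close>

lemma periodic_covering_of_equal_windows:
  assumes S: "S \<subseteq> {0..int s}" and cov: "T + S = UNIV" and d: "d \<ge> 1"
    and win: "window s T x = window s T (x + int d)"
  shows "periodic_covering S d (card (T \<inter> {x..<x + int d}))"
proof -
  define T' where "T' = {z. x + (z - x) mod int d \<in> T}"
  have dpos: "int d > 0" using d by simp
  have per: "periodic_with T' d"
    unfolding periodic_with_iff T'_def using d by (simp add: diff_add_eq[symmetric])
  \<comment> \<open>The first \<open>d\<close> places agree by construction. A later place is moved
    back by \<open>d\<close>, where the induction hypothesis applies, and forward again by equality
    of the windows.\<close>
  have agree_nat: "x + int i \<in> T' \<longleftrightarrow> x + int i \<in> T" if "i < d + s" for i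
    using that
  proof (induction i rule: less_induct)
    case (less i)
    show ?case
    proof (cases "i < d")
      case True
      then show ?thesis by (simp add: T'_def)
    next
      case False
      have "i - d < s" using less.prems False by linarith
      have eq: "x + int i = (x + int (i - d)) + int d" using False by simp
      have "x + int i \<in> T' \<longleftrightarrow> x + int (i - d) \<in> T'"
        unfolding eq using per by (simp add: periodic_with_iff)
      also have "\<dots> \<longleftrightarrow> x + int (i - d) \<in> T" using less.IH[of "i - d"] less.prems False d by simp
      also have "\<dots> \<longleftrightarrow> i - d \<in> window s T x"
        using \<open>i - d < s\<close> False by (simp add: window_def)
      also have "\<dots> \<longleftrightarrow> i - d \<in> window s T (x + int d)" by (simp add: win)
      also have "\<dots> \<longleftrightarrow> x + int i \<in> T"
        using \<open>i - d < s\<close> False by (simp add: window_def)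
      finally show ?thesis .
    qed
  qed
  have agree: "z \<in> T' \<longleftrightarrow> z \<in> T" if "x \<le> z" "z < x + int d + int s" for z
    using agree_nat[of "nat (z - x)"] that by simp
  have "\<exists>a\<in>S. z - a \<in> T'" for z
  proof -
    \<comment> \<open>The representative of \<open>z\<close> modulo \<open>d\<close> for which all
      of \<open>w - s, ..., w\<close> lies in the stretch of agreement.\<close>
    define w where "w = x + int s + (z - x - int s) mod int d"
    have w: "x + int s \<le> w" "w < x + int s + int d" using dpos by (auto simp: w_def)
    obtain a where a: "a \<in> S" "w - a \<in> T" using cov unfolding plus_eq_UNIV_iff by blast
    have "w - a \<in> T'" using a S w by (subst agree) auto
    moreover have "w mod int d = z mod int d" unfolding w_def by (simp add: mod_simps)
    then have "(w - a) mod int d = (z - a) mod int d" by (rule mod_diff_cong) simp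
    ultimately have "z - a \<in> T'" using periodic_with_cong[OF per] by blast
    then show ?thesis using a by blast
  qed
  then have "T' + S = UNIV" by (simp add: plus_eq_UNIV_iff)
  moreover have "card (T' \<inter> {0..<int d}) = card (T \<inter> {x..<x + int d})"
  proof -
    have "T' \<inter> {x..<x + int d} = T \<inter> {x..<x + int d}" using agree by auto
    then show ?thesis using card_periodic_block[OF per, of x] by simp
  qed
  ultimately show ?thesis using per unfolding periodic_covering_def by blast
qed

text \<open>A repeated window at \<open>x < y\<close> cuts the closed walk into two closed walks,
  one from \<open>x\<close> to \<open>y\<close> and one from \<open>y\<close> to
  \<open>x + l\<close>. The second closes because the windows at \<open>x\<close> and
  \<open>x + l\<close> agree by periodicity.\<close>

lemma periodic_covering_split:
  assumes S: "S \<subseteq> {0..int s}" and per: "periodic_with T l" and cov: "T + S = UNIV"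
    and c: "card (T \<inter> {0..<int l}) = c"
    and notinj: "\<not> inj_on (window s T) {0..<int l}"
  obtains l1 c1 l2 c2 where "periodic_covering S l1 c1" "periodic_covering S l2 c2"
    "l = l1 + l2" "c = c1 + c2"
proof -
  obtain x y where xy: "0 \<le> x" "x < y" "y < int l" "window s T x = window s T y"
  proof -
    obtain u v where "u \<in> {0..<int l}" "v \<in> {0..<int l}" "u \<noteq> v"
      "window s T u = window s T v"
      using notinj by (auto simp: inj_on_def)
    then show ?thesis using that[of u v] that[of v u] by force
  qed
  have win_per: "window s T (x + int l) = window s T x"
  proof -
    have "x + int l + int i \<in> T \<longleftrightarrow> x + int i \<in> T" for i
      using per unfolding periodic_with_iff by (metis add.commute add.left_commute)
    then show ?thesis by (simp add: window_def)
  qed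
  define d1 where "d1 = nat (y - x)"
  define d2 where "d2 = nat (x + int l - y)"
  have d: "x + int d1 = y" "y + int d2 = x + int l" "d1 \<ge> 1" "d2 \<ge> 1" "l = d1 + d2"
    using xy by (auto simp: d1_def d2_def)
  have 1: "periodic_covering S d1 (card (T \<inter> {x..<y}))"
    using periodic_covering_of_equal_windows[OF S cov d(3), of x] xy d by simp
  have 2: "periodic_covering S d2 (card (T \<inter> {y..<x + int l}))"
    using periodic_covering_of_equal_windows[OF S cov d(4), of y] xy d win_per by simp
  have "c = card (T \<inter> {x..<x + int l})" using card_periodic_block[OF per] c by simp
  also have "T \<inter> {x..<x + int l} = (T \<inter> {x..<y}) \<union> (T \<inter> {y..<x + int l})"
    using xy by auto
  also have "card \<dots> = card (T \<inter> {x..<y}) + card (T \<inter> {y..<x + int l})"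
    by (rule card_Un_disjoint) auto
  finally show ?thesis using that[OF 1 2] d by blast
qed

lemma inj_on_window_imp_le:
  assumes "inj_on (window s T) {0..<int l}"
  shows "l \<le> 2 ^ s"
proof -
  have "card {0..<int l} \<le> card (Pow {..<s})"
    by (rule card_inj_on_le[OF assms]) (auto simp: window_def)
  then show ?thesis by (simp add: card_Pow)
qed

section \<open>The minimal density and its identification with \<open>tau\<close>\<close>

text \<open>Only finitely many pairs have period at most \<open>2 ^ s\<close>, so one of them has
  least ratio. A longer covering repeats a window and splits into shorter ones. The bound is stated
  in product form so that it adds up over the two pieces.\<close>

lemma ex_minimal_periodic_covering:
  assumes S: "S \<subseteq> {0..int s}" and "S \<noteq> {}"
  obtains l0 c0 where "periodic_covering S l0 c0"
    "\<forall>l c. periodic_covering S l c \<longrightarrow> real c0 / real l0 * real l \<le> real c"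
proof -
  define A where "A = {(l, c). periodic_covering S l c \<and> l \<le> 2 ^ s}"
  have "A \<subseteq> {..2 ^ s} \<times> {..2 ^ s}"
    using periodic_covering_le by (fastforce simp: A_def)
  then have fin: "finite A" by (rule finite_subset) simp
  have "periodic_covering S 1 1"
    unfolding periodic_covering_def
    by (rule exI[of _ UNIV]) (use \<open>S \<noteq> {}\<close> in \<open>auto simp: periodic_with_iff plus_eq_UNIV_iff\<close>)
  then have "(1, 1) \<in> A" by (simp add: A_def)
  then have "A \<noteq> {}" by blast
  define dens where "dens q = real (snd q) / real (fst q)" for q :: "nat \<times> nat"
  obtain l0 c0 where p: "arg_min_on dens A = (l0, c0)" by force
  have mem: "(l0, c0) \<in> A"
    using arg_min_if_finite(1)[OF fin \<open>A \<noteq> {}\<close>, of dens] by (simp add: p)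
  have least: "dens (l0, c0) \<le> dens q" if "q \<in> A" for q
    using arg_min_least[OF fin \<open>A \<noteq> {}\<close> that, of dens] by (simp add: p)
  have "real c0 / real l0 * real l \<le> real c" if "periodic_covering S l c" for l c
    using that
  proof (induction l arbitrary: c rule: less_induct)
    case (less l)
    obtain T where T: "periodic_with T l" "T + S = UNIV" "card (T \<inter> {0..<int l}) = c"
      using less.prems unfolding periodic_covering_def by blast
    show ?case
    proof (cases "inj_on (window s T) {0..<int l}")
      case True
      then have "(l, c) \<in> A" using less.prems inj_on_window_imp_le by (simp add: A_def)
      then have "real c0 / real l0 \<le> real c / real l" using least by (fastforce simp: dens_def)
      then show ?thesis
        using periodic_covering_pos[OF less.prems] by (simp add: pos_le_divide_eq)
    next
      case False
      obtain l1 c1 l2 c2 where sp: "periodic_covering S l1 c1" "periodic_covering S l2 c2"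
        "l = l1 + l2" "c = c1 + c2"
        using periodic_covering_split[OF S T False] .
      have "real c0 / real l0 * real l1 \<le> real c1" "real c0 / real l0 * real l2 \<le> real c2"
        using less.IH sp periodic_covering_pos[OF sp(1)] periodic_covering_pos[OF sp(2)] by simp_all
      then show ?thesis using sp by (simp add: ring_distribs)
    qed
  qed
  moreover have "periodic_covering S l0 c0" using mem by (simp add: A_def)
  ultimately show ?thesis using that by blast
qed

lemma tau_upto_le:
  assumes "finite T" "{1..int n} \<subseteq> T + S"
  shows "tau_upto S n \<le> card T"
  unfolding tau_upto_def by (rule Least_le) (use assms in blast)

text \<open>Some finite covering exists, namely by one translate per point, so the
  \<open>LEAST\<close> in \<open>tau_upto\<close> is attained.\<close>

lemma tau_upto_witness:
  assumes "S \<noteq> {}"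
  obtains T where "finite T" "card T = tau_upto S n" "{1..int n} \<subseteq> T + S"
proof -
  obtain a where a: "a \<in> S" using assms by blast
  have "z \<in> (\<lambda>z. z - a) ` {1..int n} + S" if "z \<in> {1..int n}" for z
    using set_plus_intro[of "z - a" "(\<lambda>z. z - a) ` {1..int n}" a S] that a by auto
  then have "\<exists>m T. finite T \<and> card T = m \<and> {1..int n} \<subseteq> T + S"
    by (intro exI[of _ "(\<lambda>z. z - a) ` {1..int n}"] exI) auto
  then have "\<exists>T. finite T \<and> card T = tau_upto S n \<and> {1..int n} \<subseteq> T + S"
    unfolding tau_upto_def by (rule LeastI_ex)
  then show ?thesis using that by blast
qed

lemma periodic_covering_of_finite_covering:
  assumes T: "finite T" "{1..int n} \<subseteq> T + S" and n: "n \<ge> 1"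
  obtains c where "periodic_covering S n c" "c \<le> card T"
proof -
  define T' where "T' = {z. z mod int n \<in> (\<lambda>t. t mod int n) ` T}"
  have "periodic_with T' n" using n by (simp add: periodic_with_iff T'_def)
  moreover have "\<exists>a\<in>S. z - a \<in> T'" for z
  proof -
    \<comment> \<open>The representative of \<open>z\<close> modulo \<open>n\<close> in
      \<open>{1..n}\<close>, the range that \<open>T\<close> covers.\<close>
    define w where "w = 1 + (z - 1) mod int n"
    have "w \<in> {1..int n}" using n pos_mod_bound[of "int n" "z - 1"] unfolding w_def
      by (smt (verit) atLeastAtMost_iff of_nat_1 of_nat_mono pos_mod_sign)
    then obtain t a where ta: "t \<in> T" "a \<in> S" "w = t + a"
      using T(2) by (blast elim: set_plus_elim)
    have "w mod int n = z mod int n" by (simp add: w_def mod_simps)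
    then have "(w - a) mod int n = (z - a) mod int n" by (rule mod_diff_cong) simp
    then have "z - a \<in> T'"
      using ta unfolding T'_def
      by (metis (mono_tags) add_diff_cancel_right' imageI mem_Collect_eq)
    then show ?thesis using ta by blast
  qed
  ultimately have "periodic_covering S n (card (T' \<inter> {0..<int n}))"
    unfolding periodic_covering_def plus_eq_UNIV_iff by blast
  moreover have "card (T' \<inter> {0..<int n}) \<le> card ((\<lambda>t. t mod int n) ` T)"
    by (rule card_mono) (auto simp: T'_def T(1))
  then have "card (T' \<inter> {0..<int n}) \<le> card T" using card_image_le[OF T(1)] le_trans by blast
  ultimately show ?thesis using that by blast
qed

lemma tau_upto_le_periodic_covering:
  assumes S: "S \<subseteq> {0..int s}" and pc: "periodic_covering S l c"
  shows "real (tau_upto S n) \<le> real c / real l * real (n + s + l)"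
proof -
  obtain T where T: "periodic_with T l" "T + S = UNIV" "card (T \<inter> {0..<int l}) = c"
    using pc unfolding periodic_covering_def by blast
  have l: "l \<ge> 1" using periodic_covering_pos[OF pc] .
  \<comment> \<open>Enough blocks of length \<open>l\<close>, starting at \<open>1 - s\<close>, to
    contain every translate that can reach \<open>{1..n}\<close>; rounding costs at most one extra
    block.\<close>
  define q where "q = (n + s) div l + 1"
  define B where "B = T \<inter> {1 - int s..<1 - int s + int q * int l}"
  have ql: "n + s < q * l"
    unfolding q_def using l dividend_less_div_times[of l "n + s"] by simp
  have ql': "q * l \<le> n + s + l" unfolding q_def by simp
  have qi: "int n + int s < int q * int l" using ql by (metis of_nat_add of_nat_less_iff of_nat_mult)
  have "{1..int n} \<subseteq> B + S"
  proof
    fix z assume z: "z \<in> {1..int n}"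
    obtain a where a: "a \<in> S" "z - a \<in> T" using T(2) unfolding plus_eq_UNIV_iff by blast
    then have "z - a \<in> B" using z S qi by (auto simp: B_def)
    then have "(z - a) + a \<in> B + S" using a(1) by (rule set_plus_intro)
    then show "z \<in> B + S" by simp
  qed
  then have "tau_upto S n \<le> card B" by (intro tau_upto_le) (auto simp: B_def)
  also have "card B = q * c" unfolding B_def using card_periodic_blocks[OF T(1)] T(3) by simp
  finally have "real (tau_upto S n) \<le> real (q * c)" by (rule of_nat_mono)
  also have "\<dots> = real c / real l * real (q * l)" using l by simp
  also have "\<dots> \<le> real c / real l * real (n + s + l)"
    using ql' by (intro mult_left_mono of_nat_mono) auto
  finally show ?thesis .
qed

lemma
  assumes S: "S \<subseteq> {0..int s}" and "S \<noteq> {}"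
  shows tau_attained: "\<exists>l c. periodic_covering S l c \<and> tau S = real c / real l"
    and tau_upto_tendsto_tau: "(\<lambda>n. real (tau_upto S n) / real n) \<longlonglongrightarrow> tau S"
    and tau_le_density: "\<And>l c. periodic_covering S l c \<Longrightarrow> tau S * real l \<le> real c"
proof -
  obtain l0 c0 where pc: "periodic_covering S l0 c0"
    and min: "\<forall>l c. periodic_covering S l c \<longrightarrow> real c0 / real l0 * real l \<le> real c"
    using ex_minimal_periodic_covering[OF assms] .
  define m where "m = real c0 / real l0"
  \<comment> \<open>Wrapping an optimal finite covering modulo \<open>n\<close> yields a periodic
    covering, to which minimality of \<open>m\<close> applies.\<close>
  have lower: "m \<le> real (tau_upto S n) / real n" if n: "n \<ge> 1" for n
  proof -
    obtain T where T: "finite T" "card T = tau_upto S n" "{1..int n} \<subseteq> T + S"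
      using tau_upto_witness[OF \<open>S \<noteq> {}\<close>] .
    obtain c where "periodic_covering S n c" "c \<le> card T"
      using periodic_covering_of_finite_covering[OF T(1,3) n] .
    then have "m * real n \<le> real (tau_upto S n)" using min T(2) unfolding m_def by fastforce
    then show ?thesis using n by (simp add: pos_le_divide_eq)
  qed
  have upper: "real (tau_upto S n) / real n \<le> m + m * real (s + l0) / real n" if n: "n \<ge> 1" for n
  proof -
    have "real (tau_upto S n) \<le> m * real (n + s + l0)"
      unfolding m_def by (rule tau_upto_le_periodic_covering[OF S pc])
    then have "real (tau_upto S n) / real n \<le> m * real (n + s + l0) / real n"
      by (rule divide_right_mono) simp
    also have "\<dots> = m + m * real (s + l0) / real n" using n by (simp add: field_simps)
    finally show ?thesis .
  qed
  have lim: "(\<lambda>n. real (tau_upto S n) / real n) \<longlonglongrightarrow> m"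
  proof (rule tendsto_sandwich[OF _ _ tendsto_const])
    show "\<forall>\<^sub>F n in sequentially. m \<le> real (tau_upto S n) / real n"
      using lower eventually_sequentially by blast
    show "\<forall>\<^sub>F n in sequentially. real (tau_upto S n) / real n \<le> m + m * real (s + l0) / real n"
      using upper eventually_sequentially by blast
    show "(\<lambda>n. m + m * real (s + l0) / real n) \<longlonglongrightarrow> m" by real_asymp
  qed
  \<comment> \<open>\<open>lim\<close> in the definition of \<open>tau\<close> carries information
    only now that convergence is known.\<close>
  then have "tau S = m" unfolding tau_def by (rule limI)
  then show "\<exists>l c. periodic_covering S l c \<and> tau S = real c / real l"
    and "(\<lambda>n. real (tau_upto S n) / real n) \<longlonglongrightarrow> tau S"
    and "\<And>l c. periodic_covering S l c \<Longrightarrow> tau S * real l \<le> real c"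
    using pc lim min by (auto simp: m_def)
qed

section \<open>Optimal coverings of minimal period\<close>

lemma optimal_iff_periodic_covering:
  "(\<exists>T. optimal_periodic_covering S T l) \<longleftrightarrow>
   (\<exists>c. periodic_covering S l c \<and> real c = tau S * real l)"
proof (cases "l \<ge> 1")
  case True
  then have "periodic_density T l = tau S \<longleftrightarrow> real (card (T \<inter> {0..<int l})) = tau S * real l" for T
    by (simp add: periodic_density_def divide_eq_eq)
  then show ?thesis unfolding optimal_periodic_covering_def periodic_covering_def by blast
next
  \<comment> \<open>For \<open>l = 0\<close> the density would be a division by zero, but both sides
    fail because periods are positive.\<close>
  case False
  then show ?thesis
    using periodic_covering_pos by (auto simp: optimal_periodic_covering_def periodic_with_iff)
qed

text \<open>If a window were repeated, both pieces of the split would have density at least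
  \<open>tau S\<close> while their totals meet it exactly. So each piece would be optimal, with a
  smaller period.\<close>

lemma minimal_optimal_covering:
  assumes S: "S \<subseteq> {0..int s}" and "S \<noteq> {}"
  obtains T where "periodic_with T (min_period S)" "T + S = UNIV"
    "real (card (T \<inter> {0..<int (min_period S)})) = tau S * real (min_period S)"
    "inj_on (window s T) {0..<int (min_period S)}" "tau S > 0" "min_period S \<ge> 1"
proof -
  obtain l0 c0 where pc: "periodic_covering S l0 c0" and tau: "tau S = real c0 / real l0"
    using tau_attained[OF assms] by blast
  have l0: "l0 \<ge> 1" "c0 \<ge> 1"
    using periodic_covering_pos[OF pc] periodic_covering_card_pos[OF pc] by auto
  have "\<exists>T. optimal_periodic_covering S T l0"
    unfolding optimal_iff_periodic_covering using pc tau l0 by auto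
  then have "\<exists>T. optimal_periodic_covering S T (min_period S)"
    unfolding min_period_def by (rule LeastI)
  then obtain T where T: "periodic_with T (min_period S)" "T + S = UNIV"
    "real (card (T \<inter> {0..<int (min_period S)})) = tau S * real (min_period S)"
    unfolding optimal_iff_periodic_covering periodic_covering_def by blast
  have pos: "min_period S \<ge> 1" using T(1) by (simp add: periodic_with_def)
  have "inj_on (window s T) {0..<int (min_period S)}"
  proof (rule ccontr)
    assume notinj: "\<not> ?thesis"
    obtain l1 c1 l2 c2 where sp: "periodic_covering S l1 c1" "periodic_covering S l2 c2"
      "min_period S = l1 + l2" "card (T \<inter> {0..<int (min_period S)}) = c1 + c2"
      using periodic_covering_split[OF S T(1,2) refl notinj] .
    have "tau S * real l1 \<le> real c1" "tau S * real l2 \<le> real c2" using tau_le_density[OF assms] sp by auto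
    moreover have "real c1 + real c2 = tau S * real l1 + tau S * real l2"
      using T(3) sp by (simp add: ring_distribs)
    ultimately have "real c1 = tau S * real l1" by linarith
    then have "\<exists>T. optimal_periodic_covering S T l1"
      unfolding optimal_iff_periodic_covering using sp(1) by blast
    then have "min_period S \<le> l1" unfolding min_period_def by (rule Least_le)
    then show False using sp periodic_covering_pos[OF sp(2)] by simp
  qed
  moreover have "tau S > 0" using tau l0 by simp
  ultimately show ?thesis using that T pos by blast
qed

section \<open>Counting windows: the bounds \<open>2 ^ s\<close> and the binomial sum\<close>

text \<open>Double counting: for each of the \<open>s\<close> offsets, the starting points run
  through one full period of \<open>T\<close>.\<close>

lemma sum_card_window:
  assumes "periodic_with T l"
  shows "(\<Sum>x\<in>{0..<int l}. card (window s T x)) = s * card (T \<inter> {0..<int l})"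
proof -
  have "(\<Sum>x\<in>{0..<int l}. card (window s T x)) =
      (\<Sum>x\<in>{0..<int l}. \<Sum>i<s. if x + int i \<in> T then 1 else 0)"
    by (intro sum.cong refl) (simp add: window_def sum.If_cases Int_def)
  also have "\<dots> = (\<Sum>i<s. \<Sum>x\<in>{0..<int l}. if x + int i \<in> T then 1 else 0)"
    by (rule sum.swap)
  also have "\<dots> = (\<Sum>i<s. card (T \<inter> {0..<int l}))"
  proof (rule sum.cong[OF refl])
    fix i
    have "(\<Sum>x\<in>{0..<int l}. if x + int i \<in> T then 1 else 0) =
        card {x\<in>{0..<int l}. x + int i \<in> T}"
      by (simp add: sum.If_cases Int_def)
    also have "\<dots> = card (T \<inter> {int i..<int i + int l})"
      by (rule bij_betw_same_card[of "\<lambda>x. x + int i"],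
          rule bij_betw_byWitness[where f' = "\<lambda>z. z - int i"]) auto
    also have "\<dots> = card (T \<inter> {0..<int l})" by (rule card_periodic_block[OF assms])
    finally show "(\<Sum>x\<in>{0..<int l}. if x + int i \<in> T then 1 else 0) = card (T \<inter> {0..<int l})" .
  qed
  finally show ?thesis by simp
qed

lemma card_small_subsets:
  fixes r :: real
  shows "card {W. W \<subseteq> {..<s} \<and> real (card W) \<le> r} = (\<Sum>t\<in>{t::nat. real t \<le> r}. s choose t)"
proof -
  have fin: "finite {t::nat. real t \<le> r}"
    by (rule finite_subset[of _ "{..nat \<lfloor>r\<rfloor>}"]) (auto simp: le_nat_floor)
  have "{W. W \<subseteq> {..<s} \<and> real (card W) \<le> r} =
      (\<Union>t\<in>{t::nat. real t \<le> r}. {W. W \<subseteq> {..<s} \<and> card W = t})"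
    by auto
  also have "card \<dots> = (\<Sum>t\<in>{t::nat. real t \<le> r}. card {W. W \<subseteq> {..<s} \<and> card W = t})"
    by (rule card_UN_disjoint) (auto simp: fin)
  finally show ?thesis by (simp add: n_subsets)
qed

lemma min_period_le_pow:
  assumes "S \<subseteq> {0..int s}" "S \<noteq> {}"
  shows "min_period S \<le> 2 ^ s"
  by (rule minimal_optimal_covering[OF assms]) (rule inj_on_window_imp_le)

text \<open>Windows have \<open>s * tau S\<close> elements on average, so by Markov's inequality at least half of
  them have at most twice as many.\<close>

lemma min_period_le_sum_choose:
  assumes S: "S \<subseteq> {0..int s}" "S \<noteq> {}" and s: "s \<ge> 1"
  shows "min_period S \<le> 2 * (\<Sum>t\<in>{t::nat. real t \<le> 2 * real s * tau S}. s choose t)"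
proof -
  define l where "l = min_period S"
  obtain T where T: "periodic_with T l" "T + S = UNIV"
    "real (card (T \<inter> {0..<int l})) = tau S * real l"
    "inj_on (window s T) {0..<int l}" "tau S > 0" "l \<ge> 1"
    using minimal_optimal_covering[OF S, folded l_def] .
  define r where "r = 2 * real s * tau S"
  have r: "r > 0" using T s by (simp add: r_def)
  define G where "G = {x\<in>{0..<int l}. real (card (window s T x)) \<le> r}"
  define B where "B = {x\<in>{0..<int l}. real (card (window s T x)) > r}"
  \<comment> \<open>Each window in \<open>B\<close> has more than \<open>r\<close> elements, while
    all windows together have \<open>l * s * tau S = l * r / 2\<close>.\<close>
  have "real (card B) * r = (\<Sum>x\<in>B. r)" by simp
  also have "\<dots> \<le> (\<Sum>x\<in>B. real (card (window s T x)))"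
    by (rule sum_mono) (auto simp: B_def)
  also have "\<dots> \<le> (\<Sum>x\<in>{0..<int l}. real (card (window s T x)))"
    by (rule sum_mono2) (auto simp: B_def)
  also have "\<dots> = real (s * card (T \<inter> {0..<int l}))"
    by (subst sum_card_window[OF T(1), symmetric]) simp
  also have "\<dots> = real l / 2 * r" using T(3) by (simp add: r_def)
  finally have "real (card B) \<le> real l / 2" using r by simp
  moreover have "card B + card G = l"
  proof -
    have "card B + card G = card (B \<union> G)"
      by (rule card_Un_disjoint[symmetric])
        (auto simp: B_def G_def intro: finite_subset[of _ "{0..<int l}"])
    also have "B \<union> G = {0..<int l}" by (auto simp: B_def G_def)
    finally show ?thesis by simp
  qed
  ultimately have "l \<le> 2 * card G" by linarith
  also have "card G \<le> card {W. W \<subseteq> {..<s} \<and> real (card W) \<le> r}"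
  proof (rule card_inj_on_le)
    show "inj_on (window s T) G" using T(4) by (rule inj_on_subset) (auto simp: G_def)
    show "window s T ` G \<subseteq> {W. W \<subseteq> {..<s} \<and> real (card W) \<le> r}"
      by (auto simp: G_def window_def)
    show "finite {W. W \<subseteq> {..<s} \<and> real (card W) \<le> r}"
      by (rule finite_subset[of _ "Pow {..<s}"]) auto
  qed
  finally show ?thesis by (simp add: card_small_subsets l_def r_def)
qed

section \<open>Bounding \<open>tau\<close> by a greedy covering\<close>

text \<open>A set \<open>T\<close> of maximal size covering at least \<open>r\<close> points per translate is cheap, and by
  maximality every translate meets the uncovered set in at most \<open>r\<close> points.\<close>

lemma tau_upto_le_threshold:
  assumes S: "S \<subseteq> {0..int s}" "S \<noteq> {}" and r: "r > 0"
  shows "real (tau_upto S n) \<le> real n / r + r * real (n + s) / real (card S)"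
proof -
  have finS: "finite S" using S(1) finite_subset by blast
  have k: "card S > 0" using finS S(2) by (simp add: card_gt_0_iff)
  \<comment> \<open>Contains every \<open>x\<close> for which \<open>x + S\<close> can meet
    \<open>{1..n}\<close>; it has \<open>n + s\<close> elements.\<close>
  define X where "X = {1 - int s..int n}"
  define good where "good T \<longleftrightarrow> T \<subseteq> X \<and> r * real (card T) \<le> real (card ((T + S) \<inter> {1..int n}))" for T
  have "good {}" by (simp add: good_def)
  moreover have "card T \<le> card X" if "good T" for T
    using that by (intro card_mono) (auto simp: good_def X_def)
  ultimately obtain T where T: "good T" and max: "\<forall>T'. good T' \<longrightarrow> card T' \<le> card T"
    using ex_has_greatest_nat[of good "{}" card "Suc (card X)"] by (auto simp: less_Suc_eq_le)
  have finT: "finite T" using T finite_subset[of T X] by (simp add: good_def X_def)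
  define U where "U = {1..int n} - (T + S)"
  have finU: "finite U" by (simp add: U_def)
  \<comment> \<open>Otherwise adding \<open>x\<close> to \<open>T\<close> would gain more than
    \<open>r\<close> new points and keep \<open>T\<close> good. Such an \<open>x\<close> is not yet
    in \<open>T\<close>, since translates from \<open>T\<close> miss \<open>U\<close>.\<close>
  have meet: "real (card {u\<in>U. u - x \<in> S}) \<le> r" if x: "x \<in> X" for x
  proof (rule ccontr)
    assume neg: "\<not> ?thesis"
    have "x \<notin> T"
    proof
      assume "x \<in> T"
      have "{u\<in>U. u - x \<in> S} = {}"
      proof -
        have "u \<in> T + S" if "u - x \<in> S" for u
          using set_plus_intro[OF \<open>x \<in> T\<close> that] by simp
        then show ?thesis by (auto simp: U_def)
      qed
      then have "real (card {u\<in>U. u - x \<in> S}) = 0" by (simp only: card.empty)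
      then show False using neg r by linarith
    qed
    have "((T + S) \<inter> {1..int n}) \<union> {u\<in>U. u - x \<in> S} \<subseteq> (insert x T + S) \<inter> {1..int n}"
    proof -
      have "u \<in> insert x T + S" if "u - x \<in> S" for u
        using set_plus_intro[of x "insert x T" "u - x" S] that by simp
      moreover have "T + S \<subseteq> insert x T + S" by (rule set_plus_mono2) auto
      ultimately show ?thesis by (auto simp: U_def)
    qed
    then have "card (((T + S) \<inter> {1..int n}) \<union> {u\<in>U. u - x \<in> S}) \<le> card ((insert x T + S) \<inter> {1..int n})"
      by (rule card_mono[rotated]) simp
    moreover have "card (((T + S) \<inter> {1..int n}) \<union> {u\<in>U. u - x \<in> S}) =
        card ((T + S) \<inter> {1..int n}) + card {u\<in>U. u - x \<in> S}"
      by (rule card_Un_disjoint) (auto simp: finU, auto simp: U_def)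
    ultimately have "good (insert x T)"
      using T x neg finT \<open>x \<notin> T\<close> by (auto simp: good_def ring_distribs)
    then have "card (insert x T) \<le> card T" using max by blast
    then show False using finT \<open>x \<notin> T\<close> by simp
  qed
  \<comment> \<open>Count the pairs of \<open>u\<close> in \<open>U\<close> and \<open>x\<close> in
    \<open>X\<close> with \<open>u - x\<close> in \<open>S\<close>: each \<open>u\<close> lies in
    exactly \<open>card S\<close> of them, each \<open>x\<close> in at most
    \<open>r\<close>.\<close>
  have "real (card U) * real (card S) = (\<Sum>u\<in>U. real (card S))" by simp
  also have "\<dots> = (\<Sum>u\<in>U. \<Sum>x\<in>X. if u - x \<in> S then 1 else 0)"
  proof (rule sum.cong[OF refl])
    fix u assume u: "u \<in> U"
    have "card S = card {x\<in>X. u - x \<in> S}"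
      by (rule bij_betw_same_card[of "\<lambda>a. u - a"],
          rule bij_betw_byWitness[where f' = "\<lambda>x. u - x"]) (use S u in \<open>auto simp: X_def U_def\<close>)
    then show "real (card S) = (\<Sum>x\<in>X. if u - x \<in> S then 1 else 0)"
      by (simp add: sum.If_cases Int_def X_def)
  qed
  also have "\<dots> = (\<Sum>x\<in>X. \<Sum>u\<in>U. if u - x \<in> S then 1 else 0)" by (rule sum.swap)
  also have "\<dots> = (\<Sum>x\<in>X. real (card {u\<in>U. u - x \<in> S}))"
    by (intro sum.cong refl) (simp add: sum.If_cases Int_def finU)
  also have "\<dots> \<le> (\<Sum>x\<in>X. r)" by (rule sum_mono) (rule meet)
  also have "\<dots> = r * real (n + s)" by (simp add: X_def)
  finally have U: "real (card U) \<le> r * real (n + s) / real (card S)"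
    using k by (simp add: pos_le_divide_eq)
  have "card ((T + S) \<inter> {1..int n}) \<le> card {1..int n}" by (rule card_mono) auto
  then have "r * real (card T) \<le> real n" using T by (simp add: good_def)
  then have T': "real (card T) \<le> real n / r" using r by (simp add: field_simps)
  obtain a where a: "a \<in> S" using S(2) by blast
  \<comment> \<open>Each uncovered point gets a translate of its own.\<close>
  have "{1..int n} \<subseteq> (T \<union> (\<lambda>u. u - a) ` U) + S"
  proof
    fix z assume z: "z \<in> {1..int n}"
    show "z \<in> (T \<union> (\<lambda>u. u - a) ` U) + S"
    proof (cases "z \<in> T + S")
      case True
      then show ?thesis by (blast elim: set_plus_elim intro: set_plus_intro)
    next
      case False
      then have "(z - a) + a \<in> (T \<union> (\<lambda>u. u - a) ` U) + S"
        using z a by (intro set_plus_intro) (auto simp: U_def)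
      then show ?thesis by simp
    qed
  qed
  then have "tau_upto S n \<le> card (T \<union> (\<lambda>u. u - a) ` U)"
    by (intro tau_upto_le) (auto simp: finT finU)
  also have "\<dots> \<le> card T + card ((\<lambda>u. u - a) ` U)" by (rule card_Un_le)
  also have "\<dots> \<le> card T + card U" using card_image_le[OF finU] by simp
  finally show ?thesis using U T' by linarith
qed

lemma tau_le_threshold:
  assumes S: "S \<subseteq> {0..int s}" "S \<noteq> {}" and r: "r > 0"
  shows "tau S \<le> 1 / r + r / real (card S)"
proof (rule tendsto_le[OF sequentially_bot])
  show "(\<lambda>n. real (tau_upto S n) / real n) \<longlonglongrightarrow> tau S"
    by (rule tau_upto_tendsto_tau[OF S])
  show "(\<lambda>n. 1 / r + r / real (card S) + r * real s / real (card S) / real n)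
      \<longlonglongrightarrow> 1 / r + r / real (card S)"
    by real_asymp
  show "\<forall>\<^sub>F n in sequentially. real (tau_upto S n) / real n \<le>
      1 / r + r / real (card S) + r * real s / real (card S) / real n"
    using eventually_ge_at_top[of 1]
  proof eventually_elim
    case (elim n)
    have "real (tau_upto S n) / real n \<le> (real n / r + r * real (n + s) / real (card S)) / real n"
      by (rule divide_right_mono[OF tau_upto_le_threshold[OF assms]]) simp
    also have "\<dots> = 1 / r + r / real (card S) + r * real s / real (card S) / real n"
      using elim by (simp add: add_divide_distrib ring_distribs)
    finally show ?case .
  qed
qed

text \<open>The choice \<open>r = sqrt (card S)\<close> balances the two terms of the threshold
  bound.\<close>

lemma tau_le_sqrt:
  assumes S: "S \<subseteq> {0..int s}" "S \<noteq> {}"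
  shows "tau S \<le> 2 / sqrt (real (card S))"
proof -
  have "card S > 0" using S finite_subset by (fastforce simp: card_gt_0_iff)
  then have "sqrt (real (card S)) / real (card S) = 1 / sqrt (real (card S))"
    by (simp add: field_simps)
  then show ?thesis
    using tau_le_threshold[OF S, of "sqrt (real (card S))"] \<open>card S > 0\<close> by simp
qed

section \<open>The asymptotic bound on the period\<close>

text \<open>An exponential-moment bound: for \<open>t \<le> p\<close> the weight
  \<open>x powr (t - p)\<close> is at least 1, and the weighted sum over all \<open>t\<close> is
  evaluated by the binomial theorem.\<close>

lemma sum_choose_le_powr:
  fixes p x :: real
  assumes x: "0 < x" "x \<le> 1"
  shows "real (\<Sum>t\<in>{t::nat. real t \<le> p}. s choose t) \<le> x powr (- p) * (1 + x) ^ s"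
proof -
  define A where "A = {t::nat. real t \<le> p}"
  have finA: "finite A"
    unfolding A_def by (rule finite_subset[of _ "{..nat \<lfloor>p\<rfloor>}"]) (auto simp: le_nat_floor)
  have "(\<Sum>t\<in>A. real (s choose t)) = (\<Sum>t\<in>A \<inter> {..s}. real (s choose t))"
    by (rule sum.mono_neutral_right) (auto simp: finA binomial_eq_0)
  also have "\<dots> \<le> (\<Sum>t\<in>A \<inter> {..s}. x powr (- p) * (real (s choose t) * x ^ t))"
  proof (rule sum_mono)
    fix t assume "t \<in> A \<inter> {..s}"
    then have "x powr (real t - p) \<ge> x powr 0" using x by (intro powr_mono') (auto simp: A_def)
    then have "1 \<le> x powr (- p) * x ^ t"
      using x by (simp add: powr_realpow[symmetric] powr_add[symmetric] algebra_simps)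
    then have "real (s choose t) * 1 \<le> real (s choose t) * (x powr (- p) * x ^ t)"
      by (rule mult_left_mono) simp
    then show "real (s choose t) \<le> x powr (- p) * (real (s choose t) * x ^ t)"
      by (simp add: algebra_simps)
  qed
  also have "\<dots> \<le> (\<Sum>t\<le>s. x powr (- p) * (real (s choose t) * x ^ t))"
    by (rule sum_mono2) (use x in auto)
  also have "\<dots> = x powr (- p) * (1 + x) ^ s"
    using binomial_ring[of x 1 s] by (simp add: sum_distrib_left add.commute)
  finally show ?thesis by (simp add: A_def)
qed

text \<open>The summands account, in order, for the factor 2 of the binomial bound and for
  \<open>x powr (- p)\<close> and \<open>(1 + x) ^ s\<close> at
  \<open>x = 1 / sqrt k\<close>.\<close>

definition period_exponent :: "nat \<Rightarrow> real" where
  "period_exponent k =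
     2 / real k + 4 / sqrt (real k) * log 2 (sqrt (real k)) + log 2 (1 + 1 / sqrt (real k))"

lemma period_exponent_tendsto_0: "period_exponent \<longlonglongrightarrow> 0"
  unfolding period_exponent_def by real_asymp

lemma min_period_le_powr:
  assumes S: "S \<subseteq> {0..int s}" and k: "card S \<ge> 1" and s: "s \<ge> 1"
  shows "real (min_period S) \<le> 2 powr (real s * period_exponent (card S))"
proof -
  define k where "k = real (card S)"
  have ne: "S \<noteq> {}" using k by auto
  have k1: "k \<ge> 1" using k by (simp add: k_def)
  \<comment> \<open>From \<open>k \<le> s + 1 \<le> 2 * s\<close> the exponent
    \<open>s * (2 / k)\<close> is at least 1, so it absorbs the factor 2.\<close>
  have "card S \<le> card {0..int s}" using S by (intro card_mono) auto
  then have "k \<le> 2 * real s" using s by (simp add: k_def)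
  then have two: "2 \<le> 2 powr (real s * (2 / k))"
    using k1 powr_mono[of 1 "real s * (2 / k)" 2] by (simp add: field_simps)
  have sq: "sqrt k \<ge> 1" using k1 by simp
  \<comment> \<open>As \<open>k\<close> grows this makes \<open>log 2 (1 + x)\<close> vanish, while
    \<open>x powr (- p)\<close> costs only a logarithm times \<open>p\<close>, which is at most
    \<open>4 * s / sqrt k\<close>.\<close>
  define x where "x = 1 / sqrt k"
  have x: "0 < x" "x \<le> 1" using sq by (auto simp: x_def)
  define p where "p = 2 * real s * tau S"
  have p: "p \<le> real s * (4 / sqrt k)"
    using tau_le_sqrt[OF S ne] mult_left_mono[of "tau S" "2 / sqrt k" "2 * real s"]
    by (simp add: p_def k_def mult.commute)
  have "x powr (- p) = sqrt k powr p" using sq by (simp add: x_def powr_divide powr_minus_divide)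
  also have "\<dots> \<le> sqrt k powr (real s * (4 / sqrt k))" using sq p by (rule powr_mono[rotated])
  also have "\<dots> = 2 powr (real s * (4 / sqrt k * log 2 (sqrt k)))"
    using sq by (simp add: powr_def log_def)
  finally have xp: "x powr (- p) \<le> 2 powr (real s * (4 / sqrt k * log 2 (sqrt k)))" .
  have x1: "(1 + x) ^ s = 2 powr (real s * log 2 (1 + 1 / sqrt k))"
    using x powr_powr[of 2 "log 2 (1 + x)" "real s"]
    by (simp add: powr_realpow mult.commute flip: x_def)
  have "real (min_period S) \<le> 2 * real (\<Sum>t\<in>{t::nat. real t \<le> p}. s choose t)"
    using of_nat_mono[OF min_period_le_sum_choose[OF S ne s], where ?'a = real]
    by (simp add: p_def)
  also have "\<dots> \<le> 2 * (x powr (- p) * (1 + x) ^ s)"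
    using sum_choose_le_powr[OF x] by (intro mult_left_mono) auto
  also have "\<dots> \<le> 2 powr (real s * (2 / k)) *
      (2 powr (real s * (4 / sqrt k * log 2 (sqrt k))) * 2 powr (real s * log 2 (1 + 1 / sqrt k)))"
    using two xp x unfolding x1[symmetric] by (intro mult_mono mult_nonneg_nonneg) auto
  also have "\<dots> = 2 powr (real s * period_exponent (card S))"
    unfolding period_exponent_def k_def[symmetric] powr_add[symmetric] ring_distribs
    by (simp add: add.assoc)
  finally show ?thesis .
qed

theorem theorem5p2:
  shows "(\<forall>(s::nat) (S::int set). s \<ge> 1 \<longrightarrow> S \<subseteq> {0..int s} \<longrightarrow> S \<noteq> {} \<longrightarrow>
            min_period S \<le> min (2 ^ s) (2 * (\<Sum>t\<in>{t::nat. real t \<le> 2 * real s * tau S}. s choose t))) \<and>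
         (\<exists>f :: nat \<Rightarrow> real. f \<longlonglongrightarrow> 0 \<and>
            (\<forall>(k::nat) (s::nat) (S::int set). k \<ge> 1 \<longrightarrow> s \<ge> 1 \<longrightarrow> S \<subseteq> {0..int s} \<longrightarrow> card S = k \<longrightarrow>
               real (min_period S) \<le> 2 powr (real s * f k)))"
  using min_period_le_pow min_period_le_sum_choose period_exponent_tendsto_0 min_period_le_powr
  by (intro conjI exI[of _ period_exponent]) auto

end
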